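(* The set $\mathcal{M}\subset\mathcal{R}$ of universal distance matrices is not empty and is an everywhere dense $G_\delta$-set in the cone $\mathcal{R}$ (in the weak topology).
   Context: $\mathcal{R}$ is the cone of (infinite) distance matrices: the set of all real matrices $r=\{r_{i,j}\}_{i,j=1}^\infty$ with $r_{i,i}=0$, $r_{i,j}\ge 0$, $r_{i,j}=r_{j,i}$ and $r_{i,k}+r_{k,j}\ge r_{i,j}$ for all $i,j,k$ (zeros off the diagonal are allowed). It carries the weak topology, i.e. the topology of entrywise convergence (induced from the product topology on $\mathbf{R}^{\mathbf{N}\times\mathbf{N}}$). $\mathcal{R}_n$ is the analogous set of distance matrices of order $n$. For $r\in\mathcal{R}$, $p_n(r)=\{r_{i,j}\}_{i,j=1}^n\in\mathcal{R}_n$ is its upper-left (NW) corner of order $n$. For $q\in\mathcal{R}_n$ the set of admissible vectors is $A(q)=\{(a_1,\dots,a_n)\in\mathbf{R}^n: |a_i-a_j|\le q_{i,j}\le a_i+a_j,\ i,j=1,\dots,n\}$. A matrix $r\in\mathcal{R}$ is called universal if for every $\epsilon>0$, every $n\in\mathbf{N}$ and every $a=(a_1,\dots,a_n)\in A(p_n(r))$ there exists $m\in\mathbf{N}$ such that $\max_{i=1,\dots,n}|r_{i,m}-a_i|<\epsilon$. *)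

theory Defs
  imports "HOL-Analysis.Analysis"
begin

text \<open>
  Rows and columns are indexed by \<open>nat\<close> starting from \<open>0\<close>, so the order-\<open>n\<close> corner lives on
  \<open>{..<n} \<times> {..<n}\<close>. Finite matrices and vectors are extensional functions on their index set.
  In \<open>universal\<close>, \<open>n \<ge> 1\<close> keeps the maximum over a nonempty set.
\<close>

type_synonym matrix = "nat \<times> nat \<Rightarrow> real"

definition distance_matrices :: "matrix set"  (\<open>\<R>\<close>) where
  "\<R> = {r. (\<forall>i. r (i, i) = 0) \<and> (\<forall>i j. r (i, j) \<ge> 0) \<and> (\<forall>i j. r (i, j) = r (j, i)) \<and>
           (\<forall>i j k. r (i, k) + r (k, j) \<ge> r (i, j))}"

definition corner :: "nat \<Rightarrow> matrix \<Rightarrow> matrix" where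
  "corner n r = restrict r ({..<n} \<times> {..<n})"

definition admissible :: "nat \<Rightarrow> matrix \<Rightarrow> (nat \<Rightarrow> real) set" where
  "admissible n q =
     {a \<in> extensional {..<n}. \<forall>i<n. \<forall>j<n. \<bar>a i - a j\<bar> \<le> q (i, j) \<and> q (i, j) \<le> a i + a j}"

definition universal :: "matrix \<Rightarrow> bool" where
  "universal r \<longleftrightarrow> r \<in> \<R> \<and>
     (\<forall>\<epsilon>>0. \<forall>n\<ge>1. \<forall>a\<in>admissible n (corner n r). \<exists>m. (MAX i\<in>{..<n}. \<bar>r (i, m) - a i\<bar>) < \<epsilon>)"

definition universal_matrices :: "matrix set"  (\<open>\<M>\<close>) where
  "\<M> = {r. universal r}"

definition weak_topology :: "matrix topology" where
  "weak_topology = subtopology (product_topology (\<lambda>_. euclideanreal) UNIV) \<R>"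

end

theory Submission
  imports Defs
begin

text \<open>
  Up to a tolerance \<open>\<delta>\<close>, admissibility of a vector \<open>b\<close> is a closed condition on the matrix, and the
  McShane-type extension \<open>j \<mapsto> min\<^sub>i (b\<^sub>i + r\<^sub>i\<^sub>j) + \<delta>\<close> turns a \<open>\<delta>\<close>-admissible vector into a genuinely
  admissible one, defined on all indices, that differs from \<open>b\<close> by at most \<open>\<delta>\<close>. Hence \<open>\<M>\<close> is the
  intersection of \<open>\<R>\<close> with the countably many open sets ``\<open>b\<close> is not \<open>\<delta>\<close>-admissible or some column
  of \<open>r\<close> approximates \<open>b\<close>'' with \<open>b\<close> rational. Each of these is dense: replacing the \<open>N\<close>-th row and
  column of \<open>r\<close> by the extension of \<open>b\<close> produces the required column, and the modified matrices
  converge to \<open>r\<close> as \<open>N \<rightarrow> \<infinity>\<close>. The Baire category theorem in the closed set \<open>\<R>\<close> concludes.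
\<close>

section \<open>Near-admissible vectors and their exact extension\<close>

text \<open>Moving two entries by at most \<open>\<delta>\<close> each costs
  \<open>2 * \<delta>\<close>, so every vector within \<open>\<delta>\<close> of an admissible one
  qualifies.\<close>

definition nearly_admissible :: "nat \<Rightarrow> real \<Rightarrow> matrix \<Rightarrow> (nat \<Rightarrow> real) \<Rightarrow> bool" where
  "nearly_admissible n \<delta> r b \<longleftrightarrow>
     (\<forall>i<n. \<forall>j<n. \<bar>b i - b j\<bar> \<le> r (i, j) + 2 * \<delta> \<and> r (i, j) \<le> b i + b j + 2 * \<delta>)"

text \<open>For near-admissible \<open>b\<close>, the minimum at \<open>j < n\<close> lies between
  \<open>b j - 2 * \<delta>\<close> and \<open>b j\<close>; the shift by \<open>\<delta>\<close>
  centres this error.\<close>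

definition extension :: "nat \<Rightarrow> real \<Rightarrow> matrix \<Rightarrow> (nat \<Rightarrow> real) \<Rightarrow> nat \<Rightarrow> real" where
  "extension n \<delta> r b j = (MIN i\<in>{..<n}. b i + r (i, j)) + \<delta>"

definition approximated :: "nat \<Rightarrow> real \<Rightarrow> (nat \<Rightarrow> real) \<Rightarrow> matrix set" where
  "approximated n \<delta> b =
     {r. \<not> nearly_admissible n \<delta> r b} \<union> {r. \<exists>m. \<forall>i<n. \<bar>r (i, m) - b i\<bar> < 2 * \<delta>}"

definition replace_point :: "matrix \<Rightarrow> nat \<Rightarrow> (nat \<Rightarrow> real) \<Rightarrow> matrix" where
  "replace_point r N f = (\<lambda>(i, j).
     if i = N then (if j = N then 0 else f j) else if j = N then f i else r (i, j))"

lemma distance_matricesD: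
  assumes "r \<in> \<R>"
  shows "r (i, i) = 0" "r (i, j) \<ge> 0" "r (i, j) = r (j, i)" "r (i, j) \<le> r (i, k) + r (k, j)"
  using assms by (auto simp: distance_matrices_def)

lemma extension_le: "i < n \<Longrightarrow> extension n \<delta> r b j \<le> b i + r (i, j) + \<delta>"
  by (simp add: extension_def)

lemma extension_attained:
  assumes "n \<ge> 1"
  obtains i where "i < n" "extension n \<delta> r b j = b i + r (i, j) + \<delta>"
proof -
  have "(MIN i\<in>{..<n}. b i + r (i, j)) \<in> (\<lambda>i. b i + r (i, j)) ` {..<n}"
    using assms by (intro Min_in) (auto simp: lessThan_empty_iff)
  then show ?thesis
    using that by (auto simp: extension_def)
qed

text \<open>A minimum of 1-Lipschitz functions is 1-Lipschitz. For the sum, take minimizers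
  \<open>k\<close> and \<open>l\<close> and follow the path \<open>i\<close>, \<open>k\<close>,
  \<open>l\<close>, \<open>j\<close>: the two shifts pay for the slack in the bound on
  \<open>r (k, l)\<close>.\<close>

lemma extension_admissible:
  assumes r: "r \<in> \<R>" and n: "n \<ge> 1" and b: "nearly_admissible n \<delta> r b"
  shows "\<bar>extension n \<delta> r b i - extension n \<delta> r b j\<bar> \<le> r (i, j)"
    and "r (i, j) \<le> extension n \<delta> r b i + extension n \<delta> r b j"
proof -
  let ?f = "extension n \<delta> r b"
  have *: "?f i \<le> ?f j + r (i, j)" for i j
  proof -
    obtain k where "k < n" "?f j = b k + r (k, j) + \<delta>"
      using extension_attained[OF n] .
    then show ?thesis
      using extension_le[of k n \<delta> r b i] distance_matricesD(4)[OF r, of k i j]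
        distance_matricesD(3)[OF r, of i j] by linarith
  qed
  show "\<bar>?f i - ?f j\<bar> \<le> r (i, j)"
    using *[of i j] *[of j i] distance_matricesD(3)[OF r, of i j] by linarith
  obtain k where k: "k < n" "?f i = b k + r (k, i) + \<delta>"
    using extension_attained[OF n] .
  obtain l where l: "l < n" "?f j = b l + r (l, j) + \<delta>"
    using extension_attained[OF n] .
  have "r (k, l) \<le> b k + b l + 2 * \<delta>"
    using b k(1) l(1) by (simp add: nearly_admissible_def)
  moreover have "r (i, j) \<le> r (k, i) + r (k, l) + r (l, j)"
    using distance_matricesD(4)[OF r, of i j k] distance_matricesD(4)[OF r, of k j l]
      distance_matricesD(3)[OF r, of i k] by linarith
  ultimately show "r (i, j) \<le> ?f i + ?f j"
    using k l by linarith
qed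

lemma extension_close:
  assumes r: "r \<in> \<R>" and b: "nearly_admissible n \<delta> r b" and i: "i < n"
  shows "\<bar>extension n \<delta> r b i - b i\<bar> \<le> \<delta>"
proof -
  obtain k where k: "k < n" "extension n \<delta> r b i = b k + r (k, i) + \<delta>"
    using extension_attained[of n \<delta> r b i] i by auto
  have "\<bar>b k - b i\<bar> \<le> r (k, i) + 2 * \<delta>"
    using b k(1) i by (simp add: nearly_admissible_def)
  then show ?thesis
    using k extension_le[OF i, of \<delta> r b i] distance_matricesD(1)[OF r, of i] by linarith
qed

section \<open>Moving one point far out in the sequence\<close>

text \<open>In a triangle with the new point, the Lipschitz bound serves when that point is an
  endpoint, the sum bound when it is the intermediate point.\<close>

lemma replace_point_in_distance_matrices:
  assumes r: "r \<in> \<R>"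
    and f: "\<And>i j. \<bar>f i - f j\<bar> \<le> r (i, j)" "\<And>i j. r (i, j) \<le> f i + f j"
  shows "replace_point r N f \<in> \<R>"
proof -
  note D = distance_matricesD[OF r]
  have f0: "f i \<ge> 0" for i
    using f(2)[of i i] D(1)[of i] by linarith
  show ?thesis
    unfolding distance_matrices_def mem_Collect_eq
  proof (intro conjI allI)
    fix i j k
    show "replace_point r N f (i, i) = 0" "replace_point r N f (i, j) \<ge> 0"
      using D(1)[of i] D(2)[of i j] f0 by (simp_all add: replace_point_def)
    show "replace_point r N f (i, j) = replace_point r N f (j, i)"
      using D(3)[of i j] by (simp add: replace_point_def)
    show "replace_point r N f (i, j) \<le> replace_point r N f (i, k) + replace_point r N f (k, j)"
      using D(4)[of i j k] f(1)[of i k] f(1)[of k j] f(2)[of i j] f0[of k]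
      by (simp add: replace_point_def abs_le_iff)
  qed
qed

text \<open>Each fixed entry is left untouched once \<open>N\<close> exceeds both of its
  indices.\<close>

lemma replace_point_tendsto:
  "(\<lambda>N. replace_point r N f) \<longlonglongrightarrow> r"
proof -
  have "(\<lambda>N. replace_point r N f p) \<longlonglongrightarrow> r p" for p
  proof -
    obtain i j where p: "p = (i, j)"
      by fastforce
    have "\<forall>\<^sub>F N in sequentially. replace_point r N f p = r p"
      using eventually_gt_at_top[of "max i j"]
      by eventually_elim (auto simp: p replace_point_def)
    then show ?thesis
      by (rule tendsto_eventually)
  qed
  then have "limitin (product_topology (\<lambda>_. euclidean) UNIV) (\<lambda>N. replace_point r N f) r sequentially"
    by (simp add: limitin_componentwise)
  then show ?thesis
    by (simp add: euclidean_product_topology)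
qed

section \<open>Open dense sets in the weak topology\<close>

lemma weak_topology_eq: "weak_topology = top_of_set \<R>"
  by (simp add: weak_topology_def euclidean_product_topology)

lemma continuous_on_entry: "continuous_on UNIV (\<lambda>r::matrix. r p)"
  by (rule continuous_on_product_coordinates)

lemma closed_distance_matrices: "closed \<R>"
  unfolding distance_matrices_def
  by (intro closed_Collect_conj closed_Collect_all closed_Collect_eq closed_Collect_le
      continuous_intros continuous_on_entry)

lemma open_approximated: "open (approximated n \<delta> b)"
proof -
  have "{r. \<not> nearly_admissible n \<delta> r b} =
    (\<Union>i<n. \<Union>j<n. {r. r (i, j) + 2 * \<delta> < \<bar>b i - b j\<bar>} \<union> {r. b i + b j + 2 * \<delta> < r (i, j)})"
    by (auto simp: nearly_admissible_def not_le)
  moreover have "open \<dots>"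
    by (intro open_UN ballI open_Un open_Collect_less continuous_intros continuous_on_entry)
  moreover have "{r :: matrix. \<exists>m. \<forall>i<n. \<bar>r (i, m) - b i\<bar> < 2 * \<delta>} =
    (\<Union>m. \<Inter>i<n. {r. \<bar>r (i, m) - b i\<bar> < 2 * \<delta>})"
    by auto
  moreover have "open \<dots>"
    by (intro open_UN ballI open_INT finite_lessThan open_Collect_less continuous_intros
        continuous_on_entry)
  ultimately show ?thesis
    by (simp add: approximated_def open_Un)
qed

lemma dense_approximated:
  assumes "\<delta> > 0"
  shows "\<R> \<subseteq> closure (\<R> \<inter> approximated n \<delta> b)"
proof
  fix r assume r: "r \<in> \<R>"
  show "r \<in> closure (\<R> \<inter> approximated n \<delta> b)"
  proof (cases "r \<in> approximated n \<delta> b")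
    case True
    then show ?thesis
      using r by (intro subsetD[OF closure_subset]) simp
  next
    case False
    \<comment> \<open>For \<open>n = 0\<close> the column condition is vacuous, so \<open>r\<close>
      would lie in the set.\<close>
    then have adm: "nearly_admissible n \<delta> r b" and "n \<noteq> 0"
      by (auto simp: approximated_def)
    then have n: "n \<ge> 1"
      by simp
    define f where "f = extension n \<delta> r b"
    \<comment> \<open>With \<open>N \<ge> n\<close>, every row \<open>i < n\<close> differs from
      \<open>N\<close>, so the entry \<open>(i, N)\<close> is \<open>f i\<close>.\<close>
    have "replace_point r N f \<in> \<R> \<inter> approximated n \<delta> b" if "N \<ge> n" for N
    proof -
      have "\<bar>f i - b i\<bar> < 2 * \<delta>" if "i < n" for i
        using extension_close[OF r adm that] assms by (simp add: f_def)
      then have "\<forall>i<n. \<bar>replace_point r N f (i, N) - b i\<bar> < 2 * \<delta>"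
        using \<open>N \<ge> n\<close> by (simp add: replace_point_def)
      then have "replace_point r N f \<in> approximated n \<delta> b"
        by (auto simp only: approximated_def Un_iff mem_Collect_eq)
      moreover have "replace_point r N f \<in> \<R>"
        unfolding f_def
        by (rule replace_point_in_distance_matrices[OF r extension_admissible[OF r n adm]])
      ultimately show ?thesis
        by blast
    qed
    then have "\<forall>\<^sub>F N in sequentially. replace_point r N f \<in> closure (\<R> \<inter> approximated n \<delta> b)"
      by (intro eventually_sequentiallyI[of n] subsetD[OF closure_subset])
    then show ?thesis
      by (rule Lim_in_closed_set[OF closed_closure _ sequentially_bot replace_point_tendsto])
  qed
qed

section \<open>Universality as a countable intersection\<close>

lemma universal_iff:
  "universal r \<longleftrightarrow> r \<in> \<R> \<and>
     (\<forall>\<epsilon>>0. \<forall>n\<ge>1. \<forall>a\<in>admissible n (corner n r). \<exists>m. \<forall>i<n. \<bar>r (i, m) - a i\<bar> < \<epsilon>)"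
proof -
  have "(MAX i\<in>{..<n}. \<bar>r (i, m) - a i\<bar>) < \<epsilon> \<longleftrightarrow> (\<forall>i<n. \<bar>r (i, m) - a i\<bar> < \<epsilon>)"
    if "n \<ge> 1" for n m a and \<epsilon> :: real
    using that by (subst Max_less_iff) (auto simp: lessThan_empty_iff)
  then show ?thesis
    unfolding universal_def by (auto 0 4)
qed

lemma admissible_corner_iff:
  "a \<in> admissible n (corner n r) \<longleftrightarrow> a \<in> extensional {..<n} \<and>
     (\<forall>i<n. \<forall>j<n. \<bar>a i - a j\<bar> \<le> r (i, j) \<and> r (i, j) \<le> a i + a j)"
  by (auto simp: admissible_def corner_def)

text \<open>Universality applies to the extension of \<open>b\<close>, which is exactly admissible;
  its distance to \<open>b\<close> and the error of the column contribute \<open>\<delta>\<close>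
  each.\<close>

lemma universal_imp_approximated:
  assumes "universal r" "\<delta> > 0"
  shows "r \<in> approximated n \<delta> b"
proof (cases "n = 0 \<or> \<not> nearly_admissible n \<delta> r b")
  case False
  then have n: "n \<ge> 1" and adm: "nearly_admissible n \<delta> r b"
    by auto
  have r: "r \<in> \<R>"
    using assms(1) by (simp add: universal_def)
  define a where "a = restrict (extension n \<delta> r b) {..<n}"
  have "a \<in> admissible n (corner n r)"
    using extension_admissible[OF r n adm] by (simp add: admissible_corner_iff a_def)
  then obtain m where m: "\<forall>i<n. \<bar>r (i, m) - a i\<bar> < \<delta>"
    using assms n unfolding universal_iff by blast
  have "\<bar>r (i, m) - b i\<bar> < 2 * \<delta>" if "i < n" for i
  proof -
    have "\<bar>a i - b i\<bar> \<le> \<delta>"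
      using extension_close[OF r adm that] that by (simp add: a_def)
    moreover have "\<bar>r (i, m) - a i\<bar> < \<delta>"
      using m that by blast
    ultimately show ?thesis
      by linarith
  qed
  then show ?thesis
    unfolding approximated_def by blast
qed (auto simp: approximated_def)

lemma rational_list_approximation:
  fixes a :: "nat \<Rightarrow> real"
  assumes "\<delta> > 0"
  obtains bs :: "rat list" where "length bs = n" "\<And>i. i < n \<Longrightarrow> \<bar>of_rat (bs ! i) - a i\<bar> < \<delta>"
proof -
  have "\<exists>q. \<bar>of_rat q - a i\<bar> < \<delta>" for i
    using of_rat_dense[of "a i - \<delta>" "a i + \<delta>"] assms by (auto simp: abs_less_iff) (smt (verit))
  then obtain q where "\<And>i. \<bar>of_rat (q i) - a i\<bar> < \<delta>"
    by metis
  then show ?thesis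
    by (intro that[of "map q [0..<n]"]) auto
qed

text \<open>A rational list carries both the order and the vector, and such lists form a countable
  type. Only indices below the length matter.\<close>

definition approximated_family :: "matrix set set" where
  "approximated_family =
     range (\<lambda>(bs :: rat list, k :: nat).
       approximated (length bs) (inverse (real (Suc k))) (\<lambda>i. of_rat (bs ! i)))"

lemma universal_if_approximated:
  assumes r: "r \<in> \<R>" and app: "r \<in> \<Inter>approximated_family"
  shows "universal r"
  unfolding universal_iff
proof (intro conjI allI impI ballI r)
  fix \<epsilon> :: real and n a
  assume "\<epsilon> > 0" "1 \<le> n" and a: "a \<in> admissible n (corner n r)"
  \<comment> \<open>One third covers the rational approximation of \<open>a\<close>, two thirds the
    tolerance \<open>2 * \<delta>\<close> of the column.\<close>
  obtain k where k: "inverse (real (Suc k)) < \<epsilon> / 3"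
    using reals_Archimedean[of "\<epsilon> / 3"] \<open>\<epsilon> > 0\<close> by auto
  define \<delta> where "\<delta> = inverse (real (Suc k))"
  have \<delta>: "\<delta> > 0" "3 * \<delta> < \<epsilon>"
    using k by (auto simp: \<delta>_def simp del: of_nat_Suc)
  obtain bs where bs: "length bs = n" "\<And>i. i < n \<Longrightarrow> \<bar>of_rat (bs ! i) - a i\<bar> < \<delta>"
    using rational_list_approximation[OF \<delta>(1)] by metis
  have "nearly_admissible n \<delta> r (\<lambda>i. of_rat (bs ! i))"
    unfolding nearly_admissible_def
  proof (intro allI impI)
    fix i j assume ij: "i < n" "j < n"
    then have "\<bar>a i - a j\<bar> \<le> r (i, j)" "r (i, j) \<le> a i + a j"
      using a by (auto simp: admissible_corner_iff)
    with bs(2)[OF ij(1)] bs(2)[OF ij(2)]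
    show "\<bar>of_rat (bs ! i) - of_rat (bs ! j)\<bar> \<le> r (i, j) + 2 * \<delta> \<and>
        r (i, j) \<le> of_rat (bs ! i) + of_rat (bs ! j) + 2 * \<delta>"
      by linarith
  qed
  moreover have "r \<in> approximated n \<delta> (\<lambda>i. of_rat (bs ! i))"
    using app bs(1) by (force simp: approximated_family_def \<delta>_def)
  ultimately obtain m where m: "\<forall>i<n. \<bar>r (i, m) - of_rat (bs ! i)\<bar> < 2 * \<delta>"
    by (auto simp: approximated_def)
  have "\<bar>r (i, m) - a i\<bar> < \<epsilon>" if "i < n" for i
    using m[rule_format, OF that] bs(2)[OF that] \<delta>(2) by linarith
  then show "\<exists>m. \<forall>i<n. \<bar>r (i, m) - a i\<bar> < \<epsilon>"
    by blast
qed

lemma approximated_family_nonempty: "approximated_family \<noteq> {}"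
  by (simp add: approximated_family_def)

lemma universal_in_approximated_family:
  assumes "universal r" "T \<in> approximated_family"
  shows "r \<in> T"
proof -
  obtain bs :: "rat list" and k :: nat
    where "T = approximated (length bs) (inverse (real (Suc k))) (\<lambda>i. of_rat (bs ! i))"
    using assms(2) by (auto simp: approximated_family_def)
  then show ?thesis
    by (simp only:) (rule universal_imp_approximated[OF assms(1)], simp)
qed

section \<open>The Baire category argument\<close>

lemma universal_matrices_eq: "\<M> = \<Inter>((\<inter>) \<R> ` approximated_family)"
proof (rule set_eqI)
  fix r
  have "r \<in> \<M> \<longleftrightarrow> r \<in> \<R> \<and> r \<in> \<Inter>approximated_family"
  proof
    assume "r \<in> \<M>"
    then have "universal r"
      by (simp add: universal_matrices_def)
    moreover from this have "r \<in> \<R>"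
      by (simp add: universal_def)
    ultimately show "r \<in> \<R> \<and> r \<in> \<Inter>approximated_family"
      by (blast intro: universal_in_approximated_family)
  qed (simp add: universal_matrices_def universal_if_approximated)
  \<comment> \<open>Nonemptiness of the family puts its intersection inside \<open>\<R>\<close>; an
    empty one would give all matrices.\<close>
  also have "\<dots> \<longleftrightarrow> r \<in> \<Inter>((\<inter>) \<R> ` approximated_family)"
    using approximated_family_nonempty by blast
  finally show "r \<in> \<M> \<longleftrightarrow> r \<in> \<Inter>((\<inter>) \<R> ` approximated_family)" .
qed

theorem theorem1:
  shows "\<M> \<noteq> {} \<and> gdelta_in weak_topology \<M> \<and> weak_topology closure_of \<M> = \<R>"
proof -
  let ?G = "(\<inter>) \<R> ` approximated_family"
  have countable: "countable ?G"
    by (simp add: approximated_family_def)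
  have G: "openin weak_topology T \<and> weak_topology closure_of T = \<R>" if "T \<in> ?G" for T
  proof -
    obtain bs k where T: "T = \<R> \<inter>
        approximated (length bs) (inverse (real (Suc k))) (\<lambda>i. of_rat (bs ! i))"
      using \<open>T \<in> ?G\<close> by (auto simp: approximated_family_def)
    have "openin weak_topology T"
      unfolding weak_topology_eq T by (intro openin_open_Int open_approximated)
    moreover have "weak_topology closure_of T = \<R>"
      using dense_approximated[of "inverse (real (Suc k))" "length bs" "\<lambda>i. of_rat (bs ! i)"]
      unfolding weak_topology_eq T by (auto simp: closure_of_subtopology simp del: of_nat_Suc)
    ultimately show ?thesis ..
  qed
  \<comment> \<open>A countable power of the real line is completely metrizable, and so is its
    closed subset \<open>\<R>\<close>.\<close>
  have "completely_metrizable_space weak_topology"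
    unfolding weak_topology_eq
    by (intro completely_metrizable_space_closedin completely_metrizable_space_euclidean)
      (simp add: closed_distance_matrices)
  moreover have "topspace weak_topology = \<R>"
    by (simp add: weak_topology_eq)
  ultimately have dense: "weak_topology closure_of \<M> = \<R>"
    using Baire_category[OF disjI1 countable] G unfolding universal_matrices_eq by metis
  \<comment> \<open>Since \<open>\<R>\<close> contains the zero matrix, a set with closure
    \<open>\<R>\<close> cannot be empty.\<close>
  have "(\<lambda>_. 0) \<in> \<R>"
    by (simp add: distance_matrices_def)
  with dense have "\<M> \<noteq> {}"
    by auto
  moreover have "gdelta_in weak_topology \<M>"
    unfolding universal_matrices_eq
  proof (rule gdelta_in_Inter[OF countable])
    show "?G \<noteq> {}"
      by (simp add: approximated_family_def)
    show "gdelta_in weak_topology T" if "T \<in> ?G" for T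
      using G[OF that] by (blast intro: open_imp_gdelta_in)
  qed
  ultimately show ?thesis
    using dense by blast
qed

end
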